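(* Let $L$ be a complex Leibniz algebra such that $L/I\cong\mathfrak{D}_{\mathbb{C}}$ and $I$ is the Fock $\mathfrak{D}_{\mathbb{C}}$-module. Then $L$ admits a basis $$\Big\{\overline{1},\ \overline{x},\ \tfrac{\overline{\delta}}{\delta x},\ \overline{e},\ x^{t}\ \Big|\ t\in\mathbb{N}\cup\{0\}\Big\}$$ in which the table of multiplication has the following form (omitted products are zero): $$\begin{array}{ll} [\overline{e},\overline{x}]=\overline{x}, & [\overline{x},\overline{e}]=-\overline{x},\\ {}[\overline{e},\frac{\overline{\delta}}{\delta x}]=-\frac{\overline{\delta}}{\delta x}, & [\frac{\overline{\delta}}{\delta x},\overline{e}]=\frac{\overline{\delta}}{\delta x},\\ {}[\overline{x},\frac{\overline{\delta}}{\delta x}]=\overline{1}, & [\frac{\overline{\delta}}{\delta x},\overline{x}]=-\overline{1},\\ {}[x^t,\overline{1}]=x^t, & [x^t,\overline{x}]=x^{t+1},\\ {}[x^t,\frac{\overline{\delta}}{\delta x}]=tx^{t-1}, & [x^t,\overline{e}]=-tx^t. \end{array}$$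
   Context: A Leibniz algebra over a field is a vector space $L$ with a bilinear product $[-,-]$ satisfying $[x,[y,z]]=[[x,y],z]-[[x,z],y]$ for all $x,y,z\in L$. For a Leibniz algebra $L$, $I$ denotes the ideal generated by the squares $[x,x]$, $x\in L$; it is contained in the right annihilator of $L$ (i.e. $[y,a]=0$ for all $y\in L$, $a\in I$). The quotient $\overline{L}=L/I$ is a Lie algebra, called the corresponding Lie algebra of $L$, and $I$ is a right $\overline{L}$-module via $(a,\overline{x})\mapsto[a,x]$. Right modules over a Lie algebra satisfy $(m,[x,y])=((m,x),y)-((m,y),x)$. The complex Diamond Lie algebra $\mathfrak{D}_{\mathbb{C}}$ is the four-dimensional complex Lie algebra with basis $\{\overline{e},\overline{x},\frac{\overline{\delta}}{\delta x},\overline{1}\}$ (four formal symbols) and nonzero brackets, up to antisymmetry, $[\overline{e},\overline{x}]=\overline{x}$, $[\overline{e},\frac{\overline{\delta}}{\delta x}]=-\frac{\overline{\delta}}{\delta x}$, $[\overline{x},\frac{\overline{\delta}}{\delta x}]=\overline{1}$. The Fock $\mathfrak{D}_{\mathbb{C}}$-module is the polynomial space $\mathbb{C}[x]$ with the right $\mathfrak{D}_{\mathbb{C}}$-action given, for every $p(x)\in\mathbb{C}[x]$, by $$(p(x),\overline{1})=p(x),\quad (p(x),\overline{x})=x\,p(x),\quad \Big(p(x),\tfrac{\overline{\delta}}{\delta x}\Big)=p'(x),\quad (p(x),\overline{e})=-x\,p'(x).$$ *)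

theory Defs
  imports
    "HOL-Analysis.Analysis"
    "HOL-Library.Set_Algebras"
    "HOL-Computational_Algebra.Polynomial"
begin

locale leibniz_algebra = vector_space scale
  for scale :: "'k::field \<Rightarrow> 'a::ab_group_add \<Rightarrow> 'a" +
  fixes bracket :: "'a \<Rightarrow> 'a \<Rightarrow> 'a"
  assumes linear_left: "Vector_Spaces.linear scale scale (\<lambda>x. bracket x y)"
    and linear_right: "Vector_Spaces.linear scale scale (bracket x)"
    and leibniz: "bracket x (bracket y z) = bracket (bracket x y) z - bracket (bracket x z) y"
begin

definition leibniz_ideal :: "'a set \<Rightarrow> bool" where
  "leibniz_ideal J \<longleftrightarrow>
     subspace J \<and> (\<forall>a\<in>J. \<forall>x. bracket a x \<in> J \<and> bracket x a \<in> J)"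

definition squares_ideal :: "'a set" where
  "squares_ideal = leibniz_ideal hull (range (\<lambda>x. bracket x x))"

text \<open>The quotient by \<open>J\<close> is the set of cosets \<open>x +o J\<close>. Its operations are given by
  representatives, as unions over all choices; for an ideal \<open>J\<close> these unions are single cosets.\<close>

definition quotient_carrier :: "'a set \<Rightarrow> 'a set set" where
  "quotient_carrier J = range (\<lambda>x. x +o J)"

definition quotient_add :: "'a set \<Rightarrow> 'a set \<Rightarrow> 'a set \<Rightarrow> 'a set" where
  "quotient_add J A B = (\<Union>a\<in>A. \<Union>b\<in>B. (a + b) +o J)"

definition quotient_scale :: "'a set \<Rightarrow> 'k \<Rightarrow> 'a set \<Rightarrow> 'a set" where
  "quotient_scale J c A = (\<Union>a\<in>A. scale c a +o J)"

definition quotient_bracket :: "'a set \<Rightarrow> 'a set \<Rightarrow> 'a set \<Rightarrow> 'a set" where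
  "quotient_bracket J A B = (\<Union>a\<in>A. \<Union>b\<in>B. bracket a b +o J)"

text \<open>\<open>quotient_iso J scale' bracket' \<phi>\<close>: the map \<open>\<phi>\<close> is an isomorphism of algebras from the
  quotient by \<open>J\<close> onto the algebra given by \<open>scale'\<close> and \<open>bracket'\<close> on a whole type.\<close>

definition quotient_iso ::
  "'a set \<Rightarrow> ('k \<Rightarrow> 'b \<Rightarrow> 'b) \<Rightarrow> ('b \<Rightarrow> 'b \<Rightarrow> 'b) \<Rightarrow> ('a set \<Rightarrow> 'b::ab_group_add) \<Rightarrow> bool" where
  "quotient_iso J scale' bracket' \<phi> \<longleftrightarrow>
     bij_betw \<phi> (quotient_carrier J) UNIV \<and>
     (\<forall>A\<in>quotient_carrier J. \<forall>B\<in>quotient_carrier J.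
        \<phi> (quotient_add J A B) = \<phi> A + \<phi> B) \<and>
     (\<forall>c. \<forall>A\<in>quotient_carrier J. \<phi> (quotient_scale J c A) = scale' c (\<phi> A)) \<and>
     (\<forall>A\<in>quotient_carrier J. \<forall>B\<in>quotient_carrier J.
        \<phi> (quotient_bracket J A B) = bracket' (\<phi> A) (\<phi> B))"

text \<open>The right action \<open>(a, x + I) \<mapsto> [a, x]\<close> of the quotient by \<open>I = squares_ideal\<close> on \<open>I\<close>;
  the set \<open>bracket a ` A\<close> is a singleton because \<open>I\<close> lies in the right annihilator.\<close>

definition quotient_action :: "'a \<Rightarrow> 'a set \<Rightarrow> 'a" where
  "quotient_action a A = the_elem (bracket a ` A)"

text \<open>Let \<open>\<phi>\<close> be an isomorphism from the quotient by \<open>I = squares_ideal\<close> onto an algebra acting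
  by \<open>act\<close> from the right on a vector space. Then \<open>\<psi>\<close> is an isomorphism from \<open>I\<close> onto that module,
  where the two algebras acting are identified via \<open>\<phi>\<close>.\<close>

definition squares_module_iso ::
  "('a set \<Rightarrow> 'b) \<Rightarrow> ('k \<Rightarrow> 'm \<Rightarrow> 'm) \<Rightarrow> ('m \<Rightarrow> 'b \<Rightarrow> 'm) \<Rightarrow> ('a \<Rightarrow> 'm::ab_group_add) \<Rightarrow> bool" where
  "squares_module_iso \<phi> scale' act \<psi> \<longleftrightarrow>
     bij_betw \<psi> squares_ideal UNIV \<and>
     (\<forall>a\<in>squares_ideal. \<forall>b\<in>squares_ideal. \<psi> (a + b) = \<psi> a + \<psi> b) \<and>
     (\<forall>c. \<forall>a\<in>squares_ideal. \<psi> (scale c a) = scale' c (\<psi> a)) \<and>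
     (\<forall>a\<in>squares_ideal. \<forall>A\<in>quotient_carrier squares_ideal.
        \<psi> (quotient_action a A) = act (\<psi> a) (\<phi> A))"

definition basis_family :: "('i \<Rightarrow> 'a) \<Rightarrow> bool" where
  "basis_family b \<longleftrightarrow> inj b \<and> independent (range b) \<and> span (range b) = UNIV"

lemma bracket_simps:
  "bracket (x + y) z = bracket x z + bracket y z"
  "bracket x (y + z) = bracket x y + bracket x z"
  "bracket (scale c x) z = scale c (bracket x z)"
  "bracket x (scale c z) = scale c (bracket x z)"
  "bracket 0 x = 0" "bracket x 0 = 0"
proof -
  interpret l: Vector_Spaces.linear scale scale "\<lambda>x. bracket x y" for y by (rule linear_left)
  interpret r: Vector_Spaces.linear scale scale "bracket x" for x by (rule linear_right)
  show "bracket (x + y) z = bracket x z + bracket y z" by (rule l.add)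
  show "bracket x (y + z) = bracket x y + bracket x z" by (rule r.add)
  show "bracket (scale c x) z = scale c (bracket x z)" by (rule l.scale)
  show "bracket x (scale c z) = scale c (bracket x z)" by (rule r.scale)
  show "bracket 0 x = 0" by (rule l.zero)
  show "bracket x 0 = 0" by (rule r.zero)
qed

lemma leibniz_ideal_squares_ideal: "leibniz_ideal squares_ideal"
  unfolding squares_ideal_def
  by (rule hull_in) (auto simp: leibniz_ideal_def intro!: subspace_Inter)

lemma squares_ideal_right_annihilator:
  assumes "a \<in> squares_ideal"
  shows "bracket y a = 0"
proof -
  let ?Z = "{a. \<forall>y. bracket y a = 0}"
  have "leibniz_ideal ?Z"
    unfolding leibniz_ideal_def subspace_def by (auto simp: bracket_simps leibniz)
  moreover have "range (\<lambda>x. bracket x x) \<subseteq> ?Z"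
    by (auto simp: leibniz)
  ultimately have "squares_ideal \<subseteq> ?Z"
    unfolding squares_ideal_def by (rule hull_minimal[rotated])
  with assms show ?thesis by auto
qed

lemma coset_eq:
  assumes "subspace J" "d \<in> J" "x = y + d"
  shows "x +o J = y +o J"
proof
  show "x +o J \<subseteq> y +o J"
    using assms by (auto simp: elt_set_plus_def add.assoc intro: subspace_add)
  show "y +o J \<subseteq> x +o J"
  proof
    fix z assume "z \<in> y +o J"
    then obtain b where "b \<in> J" "z = y + b" by (auto simp: elt_set_plus_def)
    with assms have "b - d \<in> J" "z = x + (b - d)" by (auto intro: subspace_diff)
    then show "z \<in> x +o J" by (auto simp: elt_set_plus_def)
  qed
qed

lemma self_in_coset: "subspace J \<Longrightarrow> x \<in> x +o J"
  by (auto simp: elt_set_plus_def subspace_0)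

lemma
  assumes J: "leibniz_ideal J"
  shows quotient_add_coset: "quotient_add J (x +o J) (y +o J) = (x + y) +o J"
    and quotient_scale_coset: "quotient_scale J c (x +o J) = scale c x +o J"
    and quotient_bracket_coset: "quotient_bracket J (x +o J) (y +o J) = bracket x y +o J"
proof -
  have S: "subspace J" and L: "\<And>a z. a \<in> J \<Longrightarrow> bracket a z \<in> J"
    and R: "\<And>a z. a \<in> J \<Longrightarrow> bracket z a \<in> J"
    using J by (auto simp: leibniz_ideal_def)
  have ne: "x +o J \<noteq> {}" for x using self_in_coset[OF S] by blast
  have "(a + b) +o J = (x + y) +o J" if "a \<in> x +o J" "b \<in> y +o J" for a b
  proof -
    from that obtain u v where "u \<in> J" "v \<in> J" "a = x + u" "b = y + v"
      by (auto simp: elt_set_plus_def)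
    then show ?thesis by (intro coset_eq[OF S, where d = "u + v"]) (simp_all add: subspace_add[OF S] add_ac)
  qed
  then show "quotient_add J (x +o J) (y +o J) = (x + y) +o J"
    using ne[of x] ne[of y] by (simp add: quotient_add_def)
  have "scale c a +o J = scale c x +o J" if "a \<in> x +o J" for a
  proof -
    from that obtain u where "u \<in> J" "a = x + u" by (auto simp: elt_set_plus_def)
    then show ?thesis
      by (intro coset_eq[OF S, where d = "scale c u"])
        (auto intro: subspace_scale[OF S] simp: scale_right_distrib)
  qed
  then show "quotient_scale J c (x +o J) = scale c x +o J"
    using ne[of x] by (simp add: quotient_scale_def)
  have "bracket a b +o J = bracket x y +o J" if "a \<in> x +o J" "b \<in> y +o J" for a b
  proof -
    from that obtain u v where "u \<in> J" "v \<in> J" "a = x + u" "b = y + v"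
      by (auto simp: elt_set_plus_def)
    then show ?thesis
      by (intro coset_eq[OF S, where d = "bracket u y + (bracket x v + bracket u v)"])
        (simp_all add: subspace_add[OF S] L R bracket_simps add_ac)
  qed
  then show "quotient_bracket J (x +o J) (y +o J) = bracket x y +o J"
    using ne[of x] ne[of y] by (simp add: quotient_bracket_def)
qed

lemma quotient_action_coset: "quotient_action a (x +o squares_ideal) = bracket a x"
proof -
  have "bracket a ` (x +o squares_ideal) = {bracket a x}"
    using leibniz_ideal_squares_ideal self_in_coset[of squares_ideal x]
    by (auto simp: leibniz_ideal_def elt_set_plus_def bracket_simps
        squares_ideal_right_annihilator)
  then show ?thesis by (simp add: quotient_action_def)
qed

end

datatype diamond_symbol = Sym_e | Sym_x | Sym_ddx | Sym_one

lemma UNIV_diamond_symbol: "UNIV = {Sym_e, Sym_x, Sym_ddx, Sym_one}"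
  by (auto intro: diamond_symbol.exhaust)

instance diamond_symbol :: finite
  by standard (simp add: UNIV_diamond_symbol)

text \<open>The Diamond algebra is the free complex vector space \<open>complex ^ diamond_symbol\<close> on the four
  symbols.\<close>

abbreviation dia :: "diamond_symbol \<Rightarrow> complex ^ diamond_symbol" where
  "dia s \<equiv> axis s 1"

fun diamond_table :: "diamond_symbol \<Rightarrow> diamond_symbol \<Rightarrow> complex ^ diamond_symbol" where
  "diamond_table Sym_e Sym_x = dia Sym_x"
| "diamond_table Sym_x Sym_e = - dia Sym_x"
| "diamond_table Sym_e Sym_ddx = - dia Sym_ddx"
| "diamond_table Sym_ddx Sym_e = dia Sym_ddx"
| "diamond_table Sym_x Sym_ddx = dia Sym_one"
| "diamond_table Sym_ddx Sym_x = - dia Sym_one"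
| "diamond_table _ _ = 0"

definition diamond_bracket ::
  "complex ^ diamond_symbol \<Rightarrow> complex ^ diamond_symbol \<Rightarrow> complex ^ diamond_symbol" where
  "diamond_bracket u v = (\<Sum>s\<in>UNIV. \<Sum>t\<in>UNIV. (u $ s * v $ t) *s diamond_table s t)"

lemma sum_diamond_symbol:
  "sum f (UNIV :: diamond_symbol set) = f Sym_e + f Sym_x + f Sym_ddx + f Sym_one"
  by (simp add: UNIV_diamond_symbol add.assoc)

lemma diamond_bracket_dia: "diamond_bracket (dia s) (dia t) = diamond_table s t"
  by (cases s; cases t; simp add: diamond_bracket_def sum_diamond_symbol axis_def)

lemma forall_diamond_symbol: "(\<forall>s. P s) \<longleftrightarrow> P Sym_e \<and> P Sym_x \<and> P Sym_ddx \<and> P Sym_one"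
  by (metis diamond_symbol.exhaust)

lemma diamond_bracket_alternating: "diamond_bracket u u = 0"
  by (simp add: diamond_bracket_def sum_diamond_symbol vec_eq_iff forall_diamond_symbol axis_def)

interpretation diamond: leibniz_algebra "(*s)" diamond_bracket
proof
  show "diamond_bracket (x + y) z = diamond_bracket x z + diamond_bracket y z" for x y z
    by (simp add: diamond_bracket_def sum_diamond_symbol vec_eq_iff forall_diamond_symbol axis_def
        algebra_simps)
  show "diamond_bracket z (x + y) = diamond_bracket z x + diamond_bracket z y" for x y z
    by (simp add: diamond_bracket_def sum_diamond_symbol vec_eq_iff forall_diamond_symbol axis_def
        algebra_simps)
  show "diamond_bracket (c *s x) z = c *s diamond_bracket x z" for c x z
    by (simp add: diamond_bracket_def sum_diamond_symbol vec_eq_iff forall_diamond_symbol axis_def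
        algebra_simps)
  show "diamond_bracket z (c *s x) = c *s diamond_bracket z x" for c x z
    by (simp add: diamond_bracket_def sum_diamond_symbol vec_eq_iff forall_diamond_symbol axis_def
        algebra_simps)
  show "diamond_bracket x (diamond_bracket y z) =
      diamond_bracket (diamond_bracket x y) z - diamond_bracket (diamond_bracket x z) y" for x y z
    by (simp add: diamond_bracket_def sum_diamond_symbol vec_eq_iff forall_diamond_symbol axis_def
        algebra_simps)
qed

fun fock_table :: "complex poly \<Rightarrow> diamond_symbol \<Rightarrow> complex poly" where
  "fock_table p Sym_one = p"
| "fock_table p Sym_x = [:0, 1:] * p"
| "fock_table p Sym_ddx = pderiv p"
| "fock_table p Sym_e = - ([:0, 1:] * pderiv p)"

definition fock_action :: "complex poly \<Rightarrow> complex ^ diamond_symbol \<Rightarrow> complex poly" where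
  "fock_action p u = (\<Sum>s\<in>UNIV. smult (u $ s) (fock_table p s))"

lemma fock_action_dia: "fock_action p (dia s) = fock_table p s"
  by (cases s; simp add: fock_action_def sum_diamond_symbol axis_def)

lemma fock_action_diamond_bracket:
  "fock_action p (diamond_bracket u v) = fock_action (fock_action p u) v - fock_action (fock_action p v) u"
  by (simp add: fock_action_def diamond_bracket_def sum_diamond_symbol axis_def pderiv_add
      pderiv_minus pderiv_diff pderiv_smult pderiv_pCons pderiv_mult smult_add_right smult_diff_right algebra_simps
      poly_eq_poly_eq_iff[symmetric] fun_eq_iff)

end

theory Submission
  imports Defs
begin

text \<open>Let \<open>u\<close> be any lift of the central element \<open>1\<close>. Right multiplication by \<open>u\<close> maps
  \<open>L\<close> into \<open>I\<close> because \<open>1\<close> is central, and it is the identity on \<open>I\<close> because \<open>1\<close> acts on the Fock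
  module as the identity; so it is a projection onto \<open>I\<close>. Its kernel \<open>K\<close> is a complement of \<open>I\<close>, and
  \<open>[[y, z], u] = [[y, u], z] + [y, [z, u]] = [[y, u], z]\<close> shows that \<open>K\<close> is a subalgebra. Hence \<open>K\<close> is a
  copy of the Diamond algebra in \<open>L\<close>, and \<open>L = K + I\<close> splits.\<close>

lemma (in vector_space) biorthogonal_imp_basis:
  fixes f :: "'i \<Rightarrow> 'b \<Rightarrow> 'a" and b :: "'i \<Rightarrow> 'b"
  assumes add: "\<And>i x y. f i (x + y) = f i x + f i y"
    and scale: "\<And>i c x. f i (scale c x) = c * f i x"
    and b: "\<And>i j. f i (b j) = (if i = j then 1 else 0)"
  shows "inj b" and "independent (range b)"
proof -
  show inj: "inj b"
    by (rule injI) (metis b zero_neq_one)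
  show "independent (range b)"
  proof
    assume "dependent (range b)"
    then obtain i where i: "b i \<in> span (range b - {b i})"
      by (auto simp: dependent_def)
    have "f i 0 = 0"
      using scale[of i 0 0] by simp
    \<comment> \<open>The kernel of \<open>f i\<close> is a subspace that contains every member of
      the family except \<open>b i\<close>. It therefore contains their span, while
      \<open>f i (b i) = 1\<close>.\<close>
    then have "subspace {x. f i x = 0}"
      by (auto simp: subspace_def add scale)
    moreover have "range b - {b i} \<subseteq> {x. f i x = 0}"
      by (auto simp: b)
    ultimately have "span (range b - {b i}) \<subseteq> {x. f i x = 0}"
      by (rule span_minimal[rotated])
    with i have "f i (b i) = 0" by auto
    then show False by (simp add: b)
  qed
qed

context leibniz_algebra
begin

lemma coset_eq_iff:
  assumes "subspace J"
  shows "x +o J = y +o J \<longleftrightarrow> x - y \<in> J"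
proof
  assume "x +o J = y +o J"
  then have "x \<in> y +o J" using self_in_coset[OF assms] by blast
  then show "x - y \<in> J" by (auto simp: elt_set_plus_def)
next
  assume "x - y \<in> J"
  then show "x +o J = y +o J" by (intro coset_eq[OF assms]) auto
qed

text \<open>Passing to representatives turns \<phi> into a surjective algebra homomorphism on the
  whole Leibniz algebra with kernel \<open>J\<close>, so that later arguments compute with elements
  instead of cosets.\<close>

lemma
  assumes J: "leibniz_ideal J" and iso: "quotient_iso J scale' bracket' \<phi>"
  shows quotient_iso_add: "\<phi> ((x + y) +o J) = \<phi> (x +o J) + \<phi> (y +o J)"
    and quotient_iso_scale: "\<phi> (scale c x +o J) = scale' c (\<phi> (x +o J))"
    and quotient_iso_bracket: "\<phi> (bracket x y +o J) = bracket' (\<phi> (x +o J)) (\<phi> (y +o J))"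
    and quotient_iso_eq_iff: "\<phi> (x +o J) = \<phi> (y +o J) \<longleftrightarrow> x - y \<in> J"
    and quotient_iso_surj: "\<exists>x. \<phi> (x +o J) = v"
proof -
  have C: "x +o J \<in> quotient_carrier J" for x
    by (simp add: quotient_carrier_def)
  show "\<phi> ((x + y) +o J) = \<phi> (x +o J) + \<phi> (y +o J)"
    using iso C by (metis quotient_iso_def quotient_add_coset[OF J])
  show "\<phi> (scale c x +o J) = scale' c (\<phi> (x +o J))"
    using iso C by (metis quotient_iso_def quotient_scale_coset[OF J])
  show "\<phi> (bracket x y +o J) = bracket' (\<phi> (x +o J)) (\<phi> (y +o J))"
    using iso C by (metis quotient_iso_def quotient_bracket_coset[OF J])
  have bij: "bij_betw \<phi> (quotient_carrier J) UNIV"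
    using iso by (simp add: quotient_iso_def)
  show "\<phi> (x +o J) = \<phi> (y +o J) \<longleftrightarrow> x - y \<in> J"
    using inj_on_eq_iff[OF bij_betw_imp_inj_on[OF bij] C C] coset_eq_iff J
    by (simp add: leibniz_ideal_def)
  have "v \<in> \<phi> ` quotient_carrier J"
    using bij by (simp add: bij_betw_def)
  then show "\<exists>x. \<phi> (x +o J) = v"
    by (auto simp: quotient_carrier_def)
qed

lemma bracket_left_diff: "bracket (x - y) z = bracket x z - bracket y z"
  using bracket_simps(1)[of "x - y" y z] by simp

text \<open>In the Leibniz identity for \<open>y\<close>, \<open>z\<close>, \<open>u\<close> the
  term \<open>bracket y (bracket z u)\<close> vanishes, since the squares ideal lies in the right
  annihilator. As \<open>z\<close> need not be in the kernel, the kernel is even closed under right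
  multiplication by every \<open>z\<close> with \<open>bracket z u\<close> in that ideal.\<close>

lemma right_mult_kernel_right_ideal:
  assumes "bracket z u \<in> squares_ideal" and "bracket y u = 0"
  shows "bracket (bracket y z) u = 0"
  using leibniz[of y z u] assms squares_ideal_right_annihilator[of "bracket z u" y]
  by (simp add: bracket_simps)

end

lemma diamond_bracket_one_right: "diamond_bracket v (dia Sym_one) = 0"
  by (simp add: diamond_bracket_def sum_diamond_symbol axis_def)

lemma diamond_expansion: "v = (\<Sum>s\<in>UNIV. (v $ s) *s dia s)"
  by (simp add: sum_diamond_symbol vec_eq_iff forall_diamond_symbol axis_def)

theorem theorem5:
  fixes scale :: "complex \<Rightarrow> 'a::ab_group_add \<Rightarrow> 'a"
    and bracket :: "'a \<Rightarrow> 'a \<Rightarrow> 'a"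
    and \<phi> :: "'a set \<Rightarrow> complex ^ diamond_symbol"
    and \<psi> :: "'a \<Rightarrow> complex poly"
  assumes "leibniz_algebra scale bracket"
    and "leibniz_algebra.quotient_iso scale bracket
           (leibniz_algebra.squares_ideal scale bracket) (*s) diamond_bracket \<phi>"
    and "leibniz_algebra.squares_module_iso scale bracket \<phi> smult fock_action \<psi>"
  shows "let I = leibniz_algebra.squares_ideal scale bracket in
     \<exists>(one::'a) (x::'a) (ddx::'a) (e::'a) (xpow::nat \<Rightarrow> 'a).
     \<phi> (one +o I) = dia Sym_one \<and> \<phi> (x +o I) = dia Sym_x \<and>
     \<phi> (ddx +o I) = dia Sym_ddx \<and> \<phi> (e +o I) = dia Sym_e \<and>
     (\<forall>t. xpow t \<in> I \<and> \<psi> (xpow t) = monom 1 t) \<and>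
     leibniz_algebra.basis_family scale
       (case_sum (case_diamond_symbol e x ddx one) xpow) \<and>
     bracket e x = x \<and> bracket x e = - x \<and>
     bracket e ddx = - ddx \<and> bracket ddx e = ddx \<and>
     bracket x ddx = one \<and> bracket ddx x = - one \<and>
     (\<forall>t. bracket (xpow t) one = xpow t \<and>
          bracket (xpow t) x = xpow (t + 1) \<and>
          bracket (xpow t) ddx = scale (of_nat t) (xpow (t - 1)) \<and>
          bracket (xpow t) e = - scale (of_nat t) (xpow t)) \<and>
     bracket one one = 0 \<and> bracket x x = 0 \<and> bracket ddx ddx = 0 \<and> bracket e e = 0 \<and>
     bracket one x = 0 \<and> bracket x one = 0 \<and>
     bracket one ddx = 0 \<and> bracket ddx one = 0 \<and>
     bracket one e = 0 \<and> bracket e one = 0 \<and>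
     (\<forall>t. bracket one (xpow t) = 0 \<and> bracket x (xpow t) = 0 \<and>
          bracket ddx (xpow t) = 0 \<and> bracket e (xpow t) = 0) \<and>
     (\<forall>s t. bracket (xpow s) (xpow t) = 0)"
proof -
  interpret L: leibniz_algebra scale bracket by fact
  define I where "I = L.squares_ideal"
  have ideal: "L.leibniz_ideal I"
    unfolding I_def by (rule L.leibniz_ideal_squares_ideal)
  then have sub: "L.subspace I" and idealL: "\<And>a y. a \<in> I \<Longrightarrow> bracket a y \<in> I"
    by (auto simp: L.leibniz_ideal_def)
  have ann: "bracket y a = 0" if "a \<in> I" for a y
    using that L.squares_ideal_right_annihilator by (simp add: I_def)
  define q where "q y = \<phi> (y +o I)" for y
  have iso: "L.quotient_iso I (*s) diamond_bracket \<phi>"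
    using assms(2) by (simp add: I_def)
  note q_add = L.quotient_iso_add[OF ideal iso, folded q_def]
    and q_scale = L.quotient_iso_scale[OF ideal iso, folded q_def]
    and q_bracket = L.quotient_iso_bracket[OF ideal iso, folded q_def]
    and q_eq_iff = L.quotient_iso_eq_iff[OF ideal iso, folded q_def]
    and q_surj = L.quotient_iso_surj[OF ideal iso, folded q_def]
  have q_diff: "q (y - z) = q y - q z" for y z
    using q_add[of "y - z" z] by (simp add: algebra_simps)
  have q0: "q 0 = 0"
    using q_diff[of 0 0] by simp
  have q_zero_iff: "q y = 0 \<longleftrightarrow> y \<in> I" for y
    using q_eq_iff[of y 0] by (simp add: q0)
  have q_minus: "q (- y) = - q y" for y
    using q_diff[of 0 y] by (simp add: q0)
  have q_sum: "q (sum g A) = (\<Sum>s\<in>A. q (g s))" for g :: "diamond_symbol \<Rightarrow> 'a" and A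
    by (induction A rule: infinite_finite_induct) (simp_all add: q0 q_add)

  have \<psi>: "bij_betw \<psi> I UNIV"
    "\<And>a b. a \<in> I \<Longrightarrow> b \<in> I \<Longrightarrow> \<psi> (a + b) = \<psi> a + \<psi> b"
    "\<And>c a. a \<in> I \<Longrightarrow> \<psi> (scale c a) = smult c (\<psi> a)"
    using assms(3) by (simp_all add: L.squares_module_iso_def I_def)
  have \<psi>_bracket: "\<psi> (bracket a y) = fock_action (\<psi> a) (q y)" if "a \<in> I" for a y
  proof -
    have "y +o I \<in> L.quotient_carrier I"
      by (simp add: L.quotient_carrier_def)
    then show ?thesis
      using assms(3) that L.quotient_action_coset[of a y]
      by (metis L.squares_module_iso_def I_def q_def)
  qed
  have \<psi>_eqI: "a = b" if "a \<in> I" "b \<in> I" "\<psi> a = \<psi> b" for a b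
    using \<psi>(1) that by (meson bij_betw_imp_inj_on inj_onD)
  have "0 \<in> I" by (rule L.subspace_0[OF sub])
  then have \<psi>0: "\<psi> 0 = 0"
    using \<psi>(2)[of 0 0] by simp
  have \<psi>_sum: "\<psi> (sum g A) = (\<Sum>t\<in>A. \<psi> (g t))" if "\<And>t. g t \<in> I" for g :: "nat \<Rightarrow> 'a" and A
    by (induction A rule: infinite_finite_induct)
      (simp_all add: \<psi>0 \<psi>(2) that L.subspace_sum[OF sub])

  obtain u where u: "q u = dia Sym_one"
    using q_surj by blast
  have Ru_I: "bracket y u \<in> I" for y
    by (simp add: q_zero_iff[symmetric] q_bracket u diamond_bracket_one_right)
  have Ru_id: "bracket a u = a" if "a \<in> I" for a
    using that by (intro \<psi>_eqI) (simp_all add: idealL \<psi>_bracket u fock_action_dia)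

  define K where "K = {y. bracket y u = 0}"
  have K_bracket: "bracket y z \<in> K" if "y \<in> K" for y z
    using that L.right_mult_kernel_right_ideal[of z u y] Ru_I by (simp add: K_def I_def)
  have K_subspace: "L.subspace K"
    by (simp add: K_def L.subspace_def L.bracket_simps)
  have K_minus: "- y \<in> K" if "y \<in> K" for y
    using L.subspace_neg[OF K_subspace that] .
  \<comment> \<open>\<open>K\<close> meets \<open>I\<close> only in 0: right multiplication by
    \<open>u\<close> fixes the difference \<open>y - z\<close> as an element of \<open>I\<close> and
    kills it as an element of \<open>K\<close>. So \<open>q\<close> is injective on
    \<open>K\<close>.\<close>
  have K_eqI: "y = z" if "y \<in> K" "z \<in> K" "q y = q z" for y z
  proof -
    have "y - z \<in> I" using that(3) by (simp add: q_eq_iff)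
    moreover have "bracket (y - z) u = 0"
      using that by (simp add: K_def L.bracket_left_diff)
    ultimately show ?thesis using Ru_id by fastforce
  qed
  \<comment> \<open>Any preimage of \<open>v\<close> is corrected by its projection
    \<open>bracket y u\<close> to \<open>I\<close>. This does not change its image under
    \<open>q\<close>, and the result is in \<open>K\<close> because the projection is
    idempotent.\<close>
  have "\<exists>y\<in>K. q y = v" for v
  proof -
    obtain y where y: "q y = v" using q_surj by blast
    have "y - bracket y u \<in> K"
      by (simp add: K_def L.bracket_left_diff Ru_id Ru_I)
    moreover have "q (y - bracket y u) = v"
      using y Ru_I[of y] by (simp add: q_diff q_zero_iff[symmetric])
    ultimately show ?thesis by blast
  qed
  then have "\<forall>s. \<exists>y. y \<in> K \<and> q y = dia s"
    by blast
  from choice[OF this] obtain k where kK: "\<And>s. k s \<in> K" and qk: "\<And>s. q (k s) = dia s"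
    by blast
  \<comment> \<open>Products of the lifts stay in \<open>K\<close>, where \<open>q\<close> is
    injective, so the Diamond table lifts with no correction term from \<open>I\<close>.\<close>
  have k_bracket: "bracket (k s) (k t) = y" if "y \<in> K" "q y = diamond_table s t" for s t y
    using that by (intro K_eqI) (simp_all add: K_bracket kK q_bracket qk diamond_bracket_dia)
  have K0: "0 \<in> K" by (rule L.subspace_0[OF K_subspace])

  define xp where "xp t = inv_into I \<psi> (monom 1 t)" for t
  have xpI: "xp t \<in> I" and \<psi>_xp: "\<psi> (xp t) = monom 1 t" for t
    using \<psi>(1) by (auto simp: xp_def bij_betw_def inv_into_into f_inv_into_f)
  have xp_bracket: "bracket (xp t) (k s) = a" if "a \<in> I" "\<psi> a = fock_table (monom 1 t) s" for t s a
    using that by (intro \<psi>_eqI) (simp_all add: idealL xpI \<psi>_bracket qk fock_action_dia \<psi>_xp)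
  have scale_xp: "scale c (xp t) \<in> I" "\<psi> (scale c (xp t)) = monom c t" for c t
    using L.subspace_scale[OF sub xpI] by (simp_all add: \<psi>(3) xpI \<psi>_xp smult_monom)
  have X_monom: "[:0, 1:] * monom c t = monom c (t + 1)" for c :: complex and t
    by (simp add: monom_Suc)
  have xp_e: "bracket (xp t) (k Sym_e) = - scale (of_nat t) (xp t)" for t
  proof -
    \<comment> \<open>The case split is needed because \<open>t - 1 + 1\<close> differs from
      \<open>t\<close> at \<open>t = 0\<close>; there both monomials have coefficient 0.\<close>
    have "fock_table (monom 1 t) Sym_e = monom (- of_nat t) t"
      unfolding fock_table.simps pderiv_monom X_monom by (cases t) (simp_all add: minus_monom)
    then have "\<psi> (scale (- of_nat t) (xp t)) = fock_table (monom 1 t) Sym_e"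
      by (simp only: scale_xp)
    then show ?thesis
      unfolding L.scale_minus_left[symmetric] by (rule xp_bracket[OF scale_xp(1)])
  qed

  define b where "b = case_sum k xp"
  have basis: "L.basis_family b"
  proof -
    \<comment> \<open>These are the coordinate functionals dual to \<open>b\<close>. Those for
      \<open>Inl\<close> factor through \<open>q\<close> and so vanish on \<open>I\<close>; those
      for \<open>Inr\<close> first project to \<open>I\<close> by right multiplication with
      \<open>u\<close> and so vanish on \<open>K\<close>.\<close>
    define f where "f i y = (case i of Inl s \<Rightarrow> q y $ s | Inr t \<Rightarrow> coeff (\<psi> (bracket y u)) t)"
      for i :: "diamond_symbol + nat" and y
    have "f i (y + z) = f i y + f i z" "f i (scale c y) = c * f i y" for i y z c
      by (auto simp: f_def q_add q_scale L.bracket_simps \<psi>(2,3) Ru_I split: sum.split)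
    moreover have "f i (b j) = (if i = j then 1 else 0)" for i j
    proof -
      have "q (xp t) = 0" for t using xpI by (simp add: q_zero_iff)
      moreover have "bracket (k s) u = 0" for s using kK by (simp add: K_def)
      ultimately show ?thesis
        by (auto simp: f_def b_def qk axis_def Ru_id xpI \<psi>_xp \<psi>0 split: sum.split)
    qed
    ultimately have "inj b" "L.independent (range b)"
      using L.biorthogonal_imp_basis[of f b] by blast+
    moreover have "y \<in> L.span (range b)" for y
    proof -
      \<comment> \<open>Subtracting the combination of the \<open>k s\<close> with the same Diamond
        coordinates leaves an element of \<open>I\<close>. The coefficients of its image under
        \<psi> expand it in the \<open>xp t\<close>.\<close>
      define a where "a = y - (\<Sum>s\<in>UNIV. scale (q y $ s) (k s))"
      have "q a = 0"
        using diamond_expansion[of "q y"] by (simp add: a_def q_diff q_sum q_scale qk)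
      then have aI: "a \<in> I" by (simp add: q_zero_iff)
      have "\<psi> (\<Sum>t\<le>degree (\<psi> a). scale (coeff (\<psi> a) t) (xp t)) = \<psi> a"
        by (simp add: \<psi>_sum scale_xp poly_as_sum_of_monoms)
      then have a: "a = (\<Sum>t\<le>degree (\<psi> a). scale (coeff (\<psi> a) t) (xp t))"
        by (intro \<psi>_eqI) (simp_all add: aI L.subspace_sum[OF sub] scale_xp)
      have "b (Inl s) = k s" "b (Inr t) = xp t" for s t
        by (simp_all add: b_def)
      then have "k s \<in> L.span (range b)" "xp t \<in> L.span (range b)" for s t
        by (metis L.span_base rangeI)+
      then have "(\<Sum>s\<in>UNIV. scale (q y $ s) (k s)) \<in> L.span (range b)"
        "(\<Sum>t\<le>degree (\<psi> a). scale (coeff (\<psi> a) t) (xp t)) \<in> L.span (range b)"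
        by (intro L.span_sum L.span_scale; blast)+
      with a have "(\<Sum>s\<in>UNIV. scale (q y $ s) (k s)) + a \<in> L.span (range b)"
        by (metis L.span_add)
      then show ?thesis by (simp add: a_def)
    qed
    ultimately show ?thesis by (auto simp: L.basis_family_def)
  qed
  have "case_diamond_symbol (k Sym_e) (k Sym_x) (k Sym_ddx) (k Sym_one) = k"
    by (auto split: diamond_symbol.split)
  with basis have basis':
    "L.basis_family (case_sum
       (case_diamond_symbol (k Sym_e) (k Sym_x) (k Sym_ddx) (k Sym_one)) xp)"
    by (simp add: b_def)

  \<comment> \<open>Every entry of the Diamond table is 0 or plus or minus a basis symbol, so its
    lift is in \<open>K\<close> by \<open>K0\<close>, \<open>kK\<close> and \<open>K_minus\<close>.
    Products with \<open>xp t\<close> on the right vanish by \<open>ann\<close>. At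
    \<open>t = 0\<close> the truncated \<open>t - 1\<close> is harmless, since its scalar is
    0.\<close>
  show ?thesis
    unfolding Let_def I_def[symmetric] q_def[symmetric]
    by (rule exI[of _ "k Sym_one"], rule exI[of _ "k Sym_x"], rule exI[of _ "k Sym_ddx"],
        rule exI[of _ "k Sym_e"], rule exI[of _ xp], intro conjI allI)
      (simp_all add: qk xpI \<psi>_xp basis' xp_e k_bracket xp_bracket ann K0 kK K_minus q0 q_minus
        scale_xp monom_Suc pderiv_monom)
qed

end
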